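(* Let $\mathcal{G}=\{\mathcal{V},\mathcal{E}\}$ be any (finite) undirected graph with node features $\mathbf{x}=\{\mathbf{x}_i\}_{i\in\mathcal{V}}$ and edge features $\{\mathbf{e}_{i,j}\}$, and let $f_{\text{NGAT}}$ be the Normalized Graph Attention map defined in the context, with parameters $\mathbf{a},\mathbf{W}_1\neq 0,\mathbf{W}_2,\mathbf{W}_3,\mathbf{W}_e$. Suppose the attention coefficients are symmetric, i.e. $\alpha_{ij}=\alpha_{ji}$ (for all adjacent $i,j$ and for every node embedding at which they are evaluated). Then $f_{\text{NGAT}}(\cdot,\mathbf{x})$ is a contraction mapping in the sense that, for any node embeddings $\mathbf{H}=\{\mathbf{h}_i\}_{i\in\mathcal{V}}$ and $\mathbf{H}'=\{\mathbf{h}'_i\}_{i\in\mathcal{V}}$, $$d\big(f_{\text{NGAT}}(\mathbf{H},\mathbf{x}),f_{\text{NGAT}}(\mathbf{H}',\mathbf{x})\big)\le d(\mathbf{H},\mathbf{H}').$$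
   Context: Node embeddings are $\mathbf{H}=\{\mathbf{h}_i\}_{i\in\mathcal{V}}$ with $\mathbf{h}_i\in\mathbb{R}^d$. $\mathcal{N}_i$ is the set of neighbors of $i$ in $\mathcal{G}$ (not containing $i$). $\text{LeakyReLU}(x)=\max(\alpha x,x)$ applied entrywise, where $\alpha$ is a hyperparameter. Define $$\phi(\mathbf{h}_i,\mathbf{h}_j)=\mathbf{a}^{\top}\,\text{LeakyReLU}(\mathbf{W}_1\mathbf{h}_i+\mathbf{W}_2\mathbf{h}_j+\mathbf{W}_e\mathbf{e}_{i,j}),\qquad \alpha_{ij}=\frac{\exp(\phi(\mathbf{h}_i,\mathbf{h}_j))}{\sum_{k\in\mathcal{N}_i\cup\{i\}}\exp(\phi(\mathbf{h}_i,\mathbf{h}_k))}\quad (j\in\mathcal{N}_i\cup\{i\}),$$ $$f_{\text{NGAT}}(\mathbf{h}_i,\mathbf{x})=\frac{1}{\Vert\mathbf{W}_1\Vert}\Big(\alpha_{ii}(\mathbf{W}_1\mathbf{h}_i+\mathbf{W}_3\mathbf{x}_i)+\sum_{j\in\mathcal{N}_i}\alpha_{ij}(\mathbf{W}_1\mathbf{h}_j+\mathbf{W}_3\mathbf{x}_j)\Big),$$ and $f_{\text{NGAT}}(\mathbf{H},\mathbf{x})=\{f_{\text{NGAT}}(\mathbf{h}_i,\mathbf{x})\}_{i\in\mathcal{V}}$. Here $\mathbf{W}_1$ is a $d\times d$ matrix, $\mathbf{a},\mathbf{W}_2,\mathbf{W}_3,\mathbf{W}_e$ are parameters of compatible dimensions,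 $\Vert\cdot\Vert$ on vectors is a norm on $\mathbb{R}^d$ (e.g. Euclidean) and $\Vert\mathbf{W}_1\Vert$ is the induced operator norm. The distance function used is $$d(\mathbf{H},\mathbf{H}')=\Big\Vert\sum_{i\in\mathcal{V}}(\mathbf{h}_i-\mathbf{h}'_i)\Big\Vert ,$$ and the term "contraction mapping" means the (non-strict) inequality displayed in the claim. *)

theory Defs
  imports "HOL-Analysis.Analysis" "Graph_Theory.Pair_Digraph"
begin

definition is_norm :: "(real ^ 'd \<Rightarrow> real) \<Rightarrow> bool" where
  "is_norm N \<longleftrightarrow>
     (\<forall>v. 0 \<le> N v) \<and>
     (\<forall>v. N v = 0 \<longleftrightarrow> v = 0) \<and>
     (\<forall>c v. N (c *\<^sub>R v) = \<bar>c\<bar> * N v) \<and>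
     (\<forall>u v. N (u + v) \<le> N u + N v)"

(* Same shape as onorm, with N in place of the Euclidean norm. The term for v = 0 is
   0 / 0 = 0 and does not affect the supremum. *)
definition induced_norm :: "(real ^ 'd \<Rightarrow> real) \<Rightarrow> real ^ 'd ^ 'd \<Rightarrow> real" where
  "induced_norm N W = (SUP v. N (W *v v) / N v)"

lemma is_norm_norm: "is_norm (norm :: real ^ 'd \<Rightarrow> real)"
  by (auto simp: is_norm_def norm_triangle_ineq)

lemma induced_norm_norm: "induced_norm norm W = onorm ((*v) W)"
  by (simp add: induced_norm_def onorm_def)

definition leaky_relu :: "real \<Rightarrow> real ^ 'd \<Rightarrow> real ^ 'd" where
  "leaky_relu s v = (\<chi> k. max (s * v $ k) (v $ k))"

(* A symmetric arc relation encodes an undirected graph. Loops are permitted in G, but a vertex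
   is never its own neighbor. *)
definition neighbors :: "'v pair_pre_digraph \<Rightarrow> 'v \<Rightarrow> 'v set" where
  "neighbors G i = {j. (i, j) \<in> parcs G} - {i}"

(* The edge features e are a function of a pair of vertices, because the coefficient of i with
   itself uses e i i even when (i, i) is not an arc. *)
definition attn_score ::
  "real \<Rightarrow> real ^ 'd \<Rightarrow> real ^ 'd ^ 'd \<Rightarrow> real ^ 'd ^ 'd \<Rightarrow> real ^ 'q ^ 'd \<Rightarrow>
   ('v \<Rightarrow> 'v \<Rightarrow> real ^ 'q) \<Rightarrow> ('v \<Rightarrow> real ^ 'd) \<Rightarrow> 'v \<Rightarrow> 'v \<Rightarrow> real" where
  "attn_score s a W1 W2 We e H i j =
     a \<bullet> leaky_relu s (W1 *v H i + W2 *v H j + We *v e i j)"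

definition attn_coeff ::
  "'v pair_pre_digraph \<Rightarrow> real \<Rightarrow> real ^ 'd \<Rightarrow> real ^ 'd ^ 'd \<Rightarrow> real ^ 'd ^ 'd \<Rightarrow>
   real ^ 'q ^ 'd \<Rightarrow> ('v \<Rightarrow> 'v \<Rightarrow> real ^ 'q) \<Rightarrow> ('v \<Rightarrow> real ^ 'd) \<Rightarrow> 'v \<Rightarrow> 'v \<Rightarrow> real" where
  "attn_coeff G s a W1 W2 We e H i j =
     exp (attn_score s a W1 W2 We e H i j) /
     (\<Sum>k \<in> neighbors G i \<union> {i}. exp (attn_score s a W1 W2 We e H i k))"

definition ngat ::
  "(real ^ 'd \<Rightarrow> real) \<Rightarrow> 'v pair_pre_digraph \<Rightarrow> real \<Rightarrow> real ^ 'd \<Rightarrow>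
   real ^ 'd ^ 'd \<Rightarrow> real ^ 'd ^ 'd \<Rightarrow> real ^ 'p ^ 'd \<Rightarrow> real ^ 'q ^ 'd \<Rightarrow>
   ('v \<Rightarrow> 'v \<Rightarrow> real ^ 'q) \<Rightarrow> ('v \<Rightarrow> real ^ 'p) \<Rightarrow> ('v \<Rightarrow> real ^ 'd) \<Rightarrow> 'v \<Rightarrow> real ^ 'd" where
  "ngat N G s a W1 W2 W3 We e x H i =
     (1 / induced_norm N W1) *\<^sub>R
       (attn_coeff G s a W1 W2 We e H i i *\<^sub>R (W1 *v H i + W3 *v x i) +
        (\<Sum>j \<in> neighbors G i. attn_coeff G s a W1 W2 We e H i j *\<^sub>R (W1 *v H j + W3 *v x j)))"

definition embedding_dist ::
  "(real ^ 'd \<Rightarrow> real) \<Rightarrow> 'v pair_pre_digraph \<Rightarrow> ('v \<Rightarrow> real ^ 'd) \<Rightarrow> ('v \<Rightarrow> real ^ 'd) \<Rightarrow> real" where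
  "embedding_dist N G H H' = N (\<Sum>i \<in> pverts G. H i - H' i)"

end

theory Submission
  imports Defs
begin

text \<open>
  Symmetry makes the attention matrix doubly stochastic, so averaging over neighborhoods does not
  change the sum of the node terms. The summed output is therefore \<open>W1 / \<parallel>W1\<parallel>\<close> applied to the
  summed input plus a constant that depends only on the node features.
\<close>

lemma is_norm_zero: "is_norm N \<Longrightarrow> N 0 = 0"
  by (simp add: is_norm_def)

lemma is_norm_nonneg: "is_norm N \<Longrightarrow> 0 \<le> N v"
  by (simp add: is_norm_def)

text \<open>Expand \<open>v\<close> in the standard basis: each coordinate is at most
  \<open>norm v\<close> in absolute value. With \<open>norm_le_is_norm\<close> this gives the
  equivalence of \<open>N\<close> with the Euclidean norm.\<close>

lemma is_norm_le_norm:
  fixes N :: "real ^ 'd \<Rightarrow> real"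
  assumes "is_norm N"
  obtains C where "0 \<le> C" "\<And>v. N v \<le> C * norm v"
proof
  let ?C = "\<Sum>b\<in>(Basis :: (real ^ 'd) set). N b"
  have scale: "N (c *\<^sub>R v) = \<bar>c\<bar> * N v" and nonneg: "0 \<le> N v"
    and triangle: "N (u + v) \<le> N u + N v" and zero: "N 0 = 0" for c u v
    using assms by (auto simp: is_norm_def)
  have N_sum: "N (sum g A) \<le> (\<Sum>b\<in>A. N (g b))" if "finite A" for g :: "real ^ 'd \<Rightarrow> real ^ 'd" and A
    using that by (induction A) (auto simp: zero intro: order_trans[OF triangle] add_left_mono)
  show "0 \<le> ?C"
    by (simp add: nonneg sum_nonneg)
  show "N v \<le> ?C * norm v" for v
  proof -
    have "N v = N (\<Sum>b\<in>Basis. (v \<bullet> b) *\<^sub>R b)"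
      by (simp only: euclidean_representation)
    also have "\<dots> \<le> (\<Sum>b\<in>Basis. N ((v \<bullet> b) *\<^sub>R b))"
      by (intro N_sum finite_Basis)
    also have "\<dots> \<le> (\<Sum>b\<in>Basis. norm v * N b)"
      unfolding scale by (intro sum_mono mult_right_mono Basis_le_norm nonneg)
    finally show ?thesis
      by (simp add: sum_distrib_left mult.commute)
  qed
qed

text \<open>The upper bound makes \<open>N\<close> Lipschitz, so \<open>N\<close> attains a minimum
  on the compact Euclidean unit sphere. That minimum is the constant: it is positive by
  definiteness, and homogeneity carries the bound to all vectors.\<close>

lemma norm_le_is_norm:
  fixes N :: "real ^ 'd \<Rightarrow> real"
  assumes "is_norm N"
  obtains c where "0 < c" "\<And>v. c * norm v \<le> N v"
proof -
  have scale: "N (r *\<^sub>R v) = \<bar>r\<bar> * N v" and triangle: "N (u + v) \<le> N u + N v" for r u v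
    using assms by (auto simp: is_norm_def)
  obtain C where C: "0 \<le> C" "\<And>v. N v \<le> C * norm v"
    using is_norm_le_norm[OF assms] by blast
  have "N u - N v \<le> C * dist u v" for u v
    using triangle[of "u - v" v] C(2)[of "u - v"] by (simp add: dist_norm)
  then have "C-lipschitz_on UNIV N"
    by (intro lipschitz_onI C) (smt (verit) dist_commute dist_real_def)
  then have "continuous_on (sphere 0 1) N"
    by (meson continuous_on_subset lipschitz_on_continuous_on subset_UNIV)
  \<comment> \<open>A minimum exists only on a nonempty set; any coordinate axis supplies a unit
    vector.\<close>
  moreover have "axis undefined 1 \<in> sphere (0 :: real ^ 'd) 1"
    by simp
  ultimately obtain w where w: "w \<in> sphere 0 1" "\<And>v. v \<in> sphere 0 1 \<Longrightarrow> N w \<le> N v"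
    using continuous_attains_inf[OF compact_sphere] by (metis empty_iff)
  show ?thesis
  proof
    show "0 < N w"
      using assms w(1) by (auto simp: is_norm_def order_less_le)
    show "N w * norm v \<le> N v" for v
    proof (cases "v = 0")
      case False
      then have "N w \<le> N ((1 / norm v) *\<^sub>R v)"
        by (intro w(2)) simp
      with False show ?thesis
        by (simp add: scale field_simps)
    qed (use assms in \<open>auto simp: is_norm_def\<close>)
  qed
qed

text \<open>The supremum in \<open>induced_norm\<close> is taken over the reals, so it dominates its
  terms only once they are known to be bounded. Norm equivalence transfers the bound from the
  Euclidean operator norm.\<close>

lemma bdd_above_induced_norm:
  fixes N :: "real ^ 'd \<Rightarrow> real"
  assumes "is_norm N"
  shows "bdd_above (range (\<lambda>v. N (W *v v) / N v))"
proof -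
  obtain C where C: "0 \<le> C" "\<And>v. N v \<le> C * norm v"
    using is_norm_le_norm[OF assms] by blast
  obtain c where c: "0 < c" "\<And>v. c * norm v \<le> N v"
    using norm_le_is_norm[OF assms] by blast
  let ?K = "onorm ((*v) W)"
  have K: "norm (W *v v) \<le> ?K * norm v" "0 \<le> ?K" for v
    by (simp_all add: onorm onorm_pos_le matrix_vector_mul_bounded_linear)
  have "N (W *v v) / N v \<le> C * ?K / c" for v
  proof (cases "N v = 0")
    case False
    then have pos: "0 < N v"
      using assms by (auto simp: is_norm_def order_less_le)
    have "N (W *v v) \<le> C * (?K * norm v)"
      using C K by (meson mult_left_mono order_trans)
    also have "\<dots> \<le> C * (?K * (N v / c))"
      using C(1) K(2) c by (intro mult_left_mono) (auto simp: field_simps)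
    finally show ?thesis
      using pos by (simp add: field_simps)
  qed (use C c K in auto)
  then show ?thesis
    by (rule bdd_aboveI2)
qed

lemma induced_norm_nonneg:
  assumes "is_norm N"
  shows "0 \<le> induced_norm N W"
  unfolding induced_norm_def
  \<comment> \<open>The term at \<open>v = 0\<close> is \<open>0 / 0 = 0\<close>, so the supremum is
    at least 0.\<close>
  using cSUP_upper[OF UNIV_I bdd_above_induced_norm[OF assms, of W], of 0] assms
  by (simp add: is_norm_def)

lemma norm_mult_le_induced_norm:
  assumes "is_norm N"
  shows "N (W *v v) \<le> induced_norm N W * N v"
proof (cases "v = 0")
  case False
  then have "0 < N v"
    using assms by (auto simp: is_norm_def order_less_le)
  with cSUP_upper[OF UNIV_I bdd_above_induced_norm[OF assms, of W], of v] show ?thesis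
    by (simp add: induced_norm_def divide_le_eq)
qed (simp add: is_norm_zero[OF assms])

lemma normalized_mult_le:
  assumes "is_norm N"
  shows "N ((1 / induced_norm N W) *\<^sub>R (W *v v)) \<le> N v"
proof (cases "induced_norm N W = 0")
  case True
  \<comment> \<open>The scaling factor is the junk value \<open>1 / 0 = 0\<close>.\<close>
  then show ?thesis
    by (simp add: is_norm_zero[OF assms] is_norm_nonneg[OF assms])
next
  case False
  then have "0 < induced_norm N W"
    using induced_norm_nonneg[OF assms, of W] by simp
  moreover have "N ((1 / induced_norm N W) *\<^sub>R (W *v v)) = \<bar>1 / induced_norm N W\<bar> * N (W *v v)"
    using assms by (simp add: is_norm_def)
  ultimately show ?thesis
    using norm_mult_le_induced_norm[OF assms, of W v] by (simp add: divide_le_eq mult.commute)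
qed

text \<open>After the sums are exchanged, \<open>u j\<close> is weighted by a column sum of
  \<open>c\<close>. Symmetry of \<open>A\<close> and of \<open>c\<close> turns it into the sum of
  row \<open>j\<close>, which is 1.\<close>

lemma sum_symmetric_stochastic:
  fixes c :: "'a \<Rightarrow> 'a \<Rightarrow> real" and u :: "'a \<Rightarrow> 'b :: real_vector"
  assumes "finite V"
    and "\<And>i. i \<in> V \<Longrightarrow> A i \<subseteq> V"
    and "\<And>i j. i \<in> V \<Longrightarrow> j \<in> A i \<Longrightarrow> i \<in> A j"
    and "\<And>i j. i \<in> V \<Longrightarrow> j \<in> A i \<Longrightarrow> c i j = c j i"
    and "\<And>i. i \<in> V \<Longrightarrow> (\<Sum>j\<in>A i. c i j) = 1"
  shows "(\<Sum>i\<in>V. \<Sum>j\<in>A i. c i j *\<^sub>R u j) = (\<Sum>j\<in>V. u j)"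
proof -
  \<comment> \<open>The first form puts the double sum in the shape \<open>sum.swap_restrict\<close>
    expects; the second recognizes the swapped index set as \<open>A j\<close>.\<close>
  have A_eq: "A i = {j \<in> V. j \<in> A i}" "A i = {j \<in> V. i \<in> A j}" if "i \<in> V" for i
    using assms(2,3) that by blast+
  have "(\<Sum>i\<in>V. \<Sum>j\<in>A i. c i j *\<^sub>R u j) = (\<Sum>i\<in>V. \<Sum>j | j \<in> V \<and> j \<in> A i. c i j *\<^sub>R u j)"
    by (intro sum.cong A_eq refl)
  also have "\<dots> = (\<Sum>j\<in>V. \<Sum>i | i \<in> V \<and> j \<in> A i. c i j *\<^sub>R u j)"
    by (intro sum.swap_restrict assms(1))
  also have "\<dots> = (\<Sum>j\<in>V. \<Sum>i\<in>A j. c j i *\<^sub>R u j)"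
    by (intro sum.cong A_eq(2)[symmetric] refl) (metis assms(4))+
  also have "\<dots> = (\<Sum>j\<in>V. u j)"
    by (simp add: assms(5) flip: scaleR_sum_left)
  finally show ?thesis .
qed

context pair_pseudo_graph
begin

lemma neighbors_subset: "neighbors G i \<subseteq> pverts G"
  by (auto simp: neighbors_def dest: in_arcsD2)

lemma finite_neighbors: "finite (neighbors G i)"
  using neighbors_subset pair_finite_verts by (rule finite_subset)

lemma neighbors_sym: "j \<in> neighbors G i \<Longrightarrow> i \<in> neighbors G j"
  by (auto simp: neighbors_def arcs_symmetric)

lemma sum_attn_coeff: "(\<Sum>j \<in> neighbors G i \<union> {i}. attn_coeff G s a W1 W2 We e H i j) = 1"
proof -
  have "0 < (\<Sum>k \<in> neighbors G i \<union> {i}. exp (attn_score s a W1 W2 We e H i k))"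
    by (intro sum_pos) (auto simp: finite_neighbors)
  then show ?thesis
    by (simp add: attn_coeff_def flip: sum_divide_distrib)
qed

lemma sum_ngat:
  assumes "\<And>i j. i \<in> pverts G \<Longrightarrow> j \<in> neighbors G i \<Longrightarrow>
             attn_coeff G s a W1 W2 We e H i j = attn_coeff G s a W1 W2 We e H j i"
  shows "(\<Sum>i\<in>pverts G. ngat N G s a W1 W2 W3 We e x H i) =
           (1 / induced_norm N W1) *\<^sub>R (\<Sum>i\<in>pverts G. W1 *v H i + W3 *v x i)"
proof -
  let ?c = "attn_coeff G s a W1 W2 We e H"
  let ?u = "\<lambda>j. W1 *v H j + W3 *v x j"
  \<comment> \<open>Hence the separate self-term of \<open>ngat\<close> joins the sum over the
    closed neighborhood without being counted twice.\<close>
  have "i \<notin> neighbors G i" for i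
    by (simp add: neighbors_def)
  then have "ngat N G s a W1 W2 W3 We e x H i =
               (1 / induced_norm N W1) *\<^sub>R (\<Sum>j \<in> neighbors G i \<union> {i}. ?c i j *\<^sub>R ?u j)" for i
    by (simp add: ngat_def finite_neighbors)
  \<comment> \<open>Closed neighborhoods inherit symmetry from the graph, and the diagonal
    coefficients are trivially symmetric.\<close>
  moreover have "(\<Sum>i\<in>pverts G. \<Sum>j \<in> neighbors G i \<union> {i}. ?c i j *\<^sub>R ?u j) = (\<Sum>j\<in>pverts G. ?u j)"
    by (rule sum_symmetric_stochastic)
      (use assms neighbors_subset neighbors_sym sum_attn_coeff in auto)
  ultimately show ?thesis
    by (simp flip: scaleR_sum_right)
qed

end

theorem theorem1:
  fixes N :: "real ^ 'd \<Rightarrow> real"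
    and G :: "'v pair_pre_digraph"
    and s :: real
    and a :: "real ^ 'd"
    and W1 W2 :: "real ^ 'd ^ 'd"
    and W3 :: "real ^ 'p ^ 'd"
    and We :: "real ^ 'q ^ 'd"
    and e :: "'v \<Rightarrow> 'v \<Rightarrow> real ^ 'q"
    and x :: "'v \<Rightarrow> real ^ 'p"
    and H H' :: "'v \<Rightarrow> real ^ 'd"
  assumes "is_norm N"
    and "pair_pseudo_graph G"
    and "W1 \<noteq> 0"
    and "\<And>K i j. K \<in> {H, H'} \<Longrightarrow> i \<in> pverts G \<Longrightarrow> j \<in> neighbors G i \<Longrightarrow>
           attn_coeff G s a W1 W2 We e K i j = attn_coeff G s a W1 W2 We e K j i"
  shows "embedding_dist N G (ngat N G s a W1 W2 W3 We e x H) (ngat N G s a W1 W2 W3 We e x H')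
           \<le> embedding_dist N G H H'"
proof -
  interpret pair_pseudo_graph G by fact
  \<comment> \<open>Both summed outputs contain the same total of \<open>W3 *v x i\<close>, which
    cancels in the difference; linearity then pulls \<open>W1\<close> out of the sum.\<close>
  have "embedding_dist N G (ngat N G s a W1 W2 W3 We e x H) (ngat N G s a W1 W2 W3 We e x H') =
          N ((1 / induced_norm N W1) *\<^sub>R (W1 *v (\<Sum>i\<in>pverts G. H i - H' i)))"
    by (simp add: embedding_dist_def sum_subtractf sum_ngat[OF assms(4)] sum.distrib vec.diff
        linear_sum[OF matrix_vector_mul_linear] flip: scaleR_diff_right)
  then show ?thesis
    using normalized_mult_le[OF assms(1)] by (simp add: embedding_dist_def)
qed

end
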